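(* Let $U(d)$ be the group of $d\times d$ complex unitary matrices. The function $$h(Z)=-1+\sum_{i,j=1}^d |z_{i,j}|^4,\qquad Z=(z_{i,j})_{i,j=1}^d\in U(d),$$ is positive definite on $U(d)$, with $h(1)=d-1$, where $1$ denotes the identity matrix, and $\int_{U(d)} h\,d\mu=\frac{d-1}{d+1}$, where $\mu$ is the normalized Haar measure on $U(d)$. Consequently, the number of mutually unbiased bases in dimension $d$ (that is, in $\mathbb{C}^d$) cannot exceed $d+1$.
   Context: A function $h:G\to\mathbb{C}$ on a group $G$ is called positive definite if for any $m$, any $u_1,\dots,u_m\in G$ and any $c_1,\dots,c_m\in\mathbb{C}$ we have $\sum_{i,j=1}^m h(u_i^{-1}u_j)\,\overline{c_i}\,c_j\ge 0$. The normalized Haar measure is the Haar measure of total mass $1$. Two orthonormal bases $\{\mathbf{e}_1,\dots,\mathbf{e}_d\}$ and $\{\mathbf{f}_1,\dots,\mathbf{f}_d\}$ of $\mathbb{C}^d$ are called unbiased if $|\langle \mathbf{e}_j,\mathbf{f}_k\rangle|=\frac{1}{\sqrt d}$ for all $1\le j,k\le d$. A collection $\mathcal{B}_1,\dots,\mathcal{B}_m$ of orthonormal bases of $\mathbb{C}^d$ is called (pairwise) mutually unbiased if any two of them are unbiased.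
   Formalization: The bound d+1 on the number of mutually unbiased bases is stated for d ≥ 2 only; for d = 1 it fails, since any two orthonormal bases {z}, {w} of ℂ are unbiased, so arbitrarily many exist. *)

theory Defs
  imports "HOL-Analysis.Analysis" "HOL-Algebra.Group"
begin

text \<open>The dimension is \<open>d = CARD('d)\<close>; it is at least 1 because types are nonempty.\<close>

definition positive_definite :: "('a, 'b) monoid_scheme \<Rightarrow> ('a \<Rightarrow> complex) \<Rightarrow> bool" where
  "positive_definite G h \<longleftrightarrow>
     (\<forall>(m::nat) u c. (\<forall>i\<in>{1..m}. u i \<in> carrier G) \<longrightarrow>
        (\<Sum>i=1..m. \<Sum>j=1..m. h (inv\<^bsub>G\<^esub> (u i) \<otimes>\<^bsub>G\<^esub> u j) * cnj (c i) * c j) \<in> \<real>\<^sub>\<ge>\<^sub>0)"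

definition conj_transpose :: "complex ^ 'n ^ 'm \<Rightarrow> complex ^ 'm ^ 'n" where
  "conj_transpose A = (\<chi> i j. cnj (A $ j $ i))"

definition unitary_group :: "(complex ^ 'd ^ 'd :: finite) monoid" where
  "unitary_group =
     \<lparr>carrier = {Z. conj_transpose Z ** Z = mat 1 \<and> Z ** conj_transpose Z = mat 1},
      mult = (**), one = mat 1\<rparr>"

lemma conj_transpose_mult: "conj_transpose (A ** B) = conj_transpose B ** conj_transpose A"
  by (simp add: conj_transpose_def matrix_matrix_mult_def vec_eq_iff mult.commute)

lemma conj_transpose_conj_transpose [simp]: "conj_transpose (conj_transpose A) = A"
  by (simp add: conj_transpose_def vec_eq_iff)

lemma conj_transpose_mat_1 [simp]: "conj_transpose (mat 1) = mat 1"
  by (simp add: conj_transpose_def mat_def vec_eq_iff)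

lemma group_unitary_group: "group (unitary_group :: (complex ^ 'd ^ 'd :: finite) monoid)"
proof (rule groupI)
  fix X Y :: "complex ^ 'd ^ 'd"
  assume "X \<in> carrier unitary_group" "Y \<in> carrier unitary_group"
  then have *: "conj_transpose X ** X = mat 1" "X ** conj_transpose X = mat 1"
    "conj_transpose Y ** Y = mat 1" "Y ** conj_transpose Y = mat 1"
    by (auto simp: unitary_group_def)
  have "conj_transpose Y ** conj_transpose X ** (X ** Y)
      = conj_transpose Y ** (conj_transpose X ** X) ** Y"
    by (simp add: matrix_mul_assoc)
  moreover have "X ** Y ** (conj_transpose Y ** conj_transpose X)
      = X ** (Y ** conj_transpose Y) ** conj_transpose X"
    by (simp add: matrix_mul_assoc)
  ultimately show "X \<otimes>\<^bsub>unitary_group\<^esub> Y \<in> carrier unitary_group"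
    using * by (simp add: unitary_group_def conj_transpose_mult)
next
  fix X :: "complex ^ 'd ^ 'd"
  assume "X \<in> carrier unitary_group"
  then show "\<exists>Y\<in>carrier unitary_group. Y \<otimes>\<^bsub>unitary_group\<^esub> X = \<one>\<^bsub>unitary_group\<^esub>"
    by (intro bexI[of _ "conj_transpose X"]) (auto simp: unitary_group_def)
qed (auto simp: unitary_group_def matrix_mul_assoc)

text \<open>
  Since the unitary group is compact and metrizable, every finite Borel measure on it is regular,
  so regularity is not a separate clause.
\<close>

definition normalized_haar_measure :: "(complex ^ 'd ^ 'd :: finite) measure \<Rightarrow> bool" where
  "normalized_haar_measure \<mu> \<longleftrightarrow>
     sets \<mu> = sets (restrict_space borel (carrier unitary_group)) \<and>
     emeasure \<mu> (space \<mu>) = 1 \<and>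
     (\<forall>g\<in>carrier unitary_group. \<forall>A\<in>sets \<mu>.
        emeasure \<mu> ((\<lambda>Z. g \<otimes>\<^bsub>unitary_group\<^esub> Z) ` A) = emeasure \<mu> A)"

definition mub_function :: "complex ^ 'd ^ 'd :: finite \<Rightarrow> real" where
  "mub_function Z = - 1 + (\<Sum>i\<in>UNIV. \<Sum>j\<in>UNIV. cmod (Z $ i $ j) ^ 4)"

definition cinner :: "complex ^ 'd :: finite \<Rightarrow> complex ^ 'd \<Rightarrow> complex" where
  "cinner x y = (\<Sum>i\<in>UNIV. x $ i * cnj (y $ i))"

text \<open>Here \<open>vec.span\<close> is the span with complex coefficients.\<close>

definition orthonormal_basis :: "(complex ^ 'd :: finite) set \<Rightarrow> bool" where
  "orthonormal_basis B \<longleftrightarrow>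
     (\<forall>x\<in>B. \<forall>y\<in>B. cinner x y = (if x = y then 1 else 0)) \<and> vec.span B = UNIV"

definition unbiased :: "(complex ^ 'd :: finite) set \<Rightarrow> (complex ^ 'd) set \<Rightarrow> bool" where
  "unbiased E F \<longleftrightarrow> (\<forall>e\<in>E. \<forall>f\<in>F. cmod (cinner e f) = 1 / sqrt (real CARD('d)))"

text \<open>
  In dimension 1 any two orthonormal bases are unbiased, even a basis and itself, so there the
  number \<open>m\<close> is unbounded; bounds on \<open>m\<close> need \<open>CARD('d) \<ge> 2\<close>.
\<close>

definition mutually_unbiased_bases :: "nat \<Rightarrow> (nat \<Rightarrow> (complex ^ 'd :: finite) set) \<Rightarrow> bool" where
  "mutually_unbiased_bases m B \<longleftrightarrow>
     (\<forall>i\<in>{1..m}. orthonormal_basis (B i)) \<and>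
     (\<forall>i\<in>{1..m}. \<forall>j\<in>{1..m}. i \<noteq> j \<longrightarrow> unbiased (B i) (B j))"

end

theory Submission
  imports Defs
begin

text \<open>
  Send a unit vector \<open>x\<close> to \<open>P \<otimes> P\<close>, where \<open>P\<close> is the projector onto \<open>x\<close>; the inner product of two
  such tensors is \<open>\<bar>\<langle>x, y\<rangle>\<bar>\<^sup>4\<close>. Summing over an orthonormal basis and removing the component along the
  identity \<open>I \<otimes> I\<close> gives a tensor \<open>T\<close>, and \<open>h(U\<^sup>*V)\<close> is the inner product of the tensors attached to the
  columns of \<open>V\<close> and \<open>U\<close>, so \<open>h\<close> is positive definite. Mutually unbiased bases have orthogonal tensors
  of squared norm \<open>d - 1\<close>. All of them have inner product \<open>d - 1\<close> with the centred swap operator,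
  whose squared norm is \<open>d\<^sup>2 - 1\<close>, and Bessel's inequality yields \<open>m \<le> d + 1\<close>.

  For the integral, fix a column \<open>z\<close> and left-multiply by the unitaries that replace \<open>z\<^sub>i, z\<^sub>k\<close> by
  \<open>(z\<^sub>i \<plusminus> \<zeta> z\<^sub>k) / \<surd>2\<close>, for \<open>\<zeta> = 1\<close> and \<open>\<zeta> = \<i>\<close>. Invariance gives
  \<open>4 E \<bar>z\<^sub>i z\<^sub>k\<bar>\<^sup>2 = E \<bar>z\<^sub>i\<bar>\<^sup>4 + E \<bar>z\<^sub>k\<bar>\<^sup>4\<close> for \<open>i \<noteq> k\<close>. Expanding \<open>(\<Sum>\<^sub>i \<bar>z\<^sub>i\<bar>\<^sup>2)\<^sup>2 = 1\<close> then determines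
  \<open>\<Sum>\<^sub>i E \<bar>z\<^sub>i\<bar>\<^sup>4 = 2 / (d + 1)\<close>.
\<close>

section \<open>Sesquilinearity and positivity of the inner product\<close>

lemma cinner_diff_left: "cinner (x - y) z = cinner x z - cinner y z"
  by (simp add: cinner_def algebra_simps sum_subtractf)

lemma cinner_diff_right: "cinner x (y - z) = cinner x y - cinner x z"
  by (simp add: cinner_def algebra_simps sum_subtractf)

lemma cinner_scale_left: "cinner (c *s x) y = c * cinner x y"
  by (simp add: cinner_def sum_distrib_left mult.assoc)

lemma cinner_scale_right: "cinner x (c *s y) = cnj c * cinner x y"
  by (simp add: cinner_def sum_distrib_left mult_ac)

lemma cinner_sum_left: "cinner (sum f K) y = (\<Sum>k\<in>K. cinner (f k) y)"
  by (simp add: cinner_def sum_distrib_right sum_component) (rule sum.swap)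

lemma cinner_sum_right: "cinner x (sum f K) = (\<Sum>k\<in>K. cinner x (f k))"
  by (simp add: cinner_def sum_distrib_left sum_component) (rule sum.swap)

lemma cnj_cinner: "cnj (cinner x y) = cinner y x"
  by (simp add: cinner_def mult.commute)

lemma cinner_self: "cinner x x = complex_of_real (\<Sum>i\<in>UNIV. (cmod (x $ i))\<^sup>2)"
  by (simp add: cinner_def complex_norm_square del: of_real_power)

lemma cinner_self_nonneg: "cinner x x \<in> \<real>\<^sub>\<ge>\<^sub>0"
  unfolding cinner_self by (simp add: sum_nonneg del: of_real_sum of_real_power)

section \<open>Tensors of vectors and frames, and their inner products\<close>

lemma sum_UNIV_quadruple:
  "(\<Sum>q\<in>UNIV. f q) = (\<Sum>a\<in>UNIV. \<Sum>b\<in>UNIV. \<Sum>c\<in>UNIV. \<Sum>e\<in>UNIV. f (a :: 'a :: finite, b :: 'b :: finite, c :: 'c :: finite, e :: 'e :: finite))"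
  by (simp add: sum.cartesian_product split_def flip: UNIV_Times_UNIV)

type_synonym 'd tensor = "complex ^ ('d \<times> 'd \<times> 'd \<times> 'd)"

text \<open>
  The operator on \<open>\<complex>\<^sup>d \<otimes> \<complex>\<^sup>d\<close> with row index \<open>(a, c)\<close> and column index \<open>(b, e)\<close> is stored as the vector of
  its entries at \<open>(a, b, c, e)\<close>.
\<close>

definition projector_square :: "complex ^ 'd :: finite \<Rightarrow> 'd tensor" where
  "projector_square x = (\<chi> q. case q of (a, b, c, e) \<Rightarrow> x $ a * cnj (x $ b) * (x $ c * cnj (x $ e)))"

definition identity_tensor :: "'d :: finite tensor" where
  "identity_tensor = (\<chi> q. case q of (a, b, c, e) \<Rightarrow> (if a = b then 1 else 0) * (if c = e then 1 else 0))"

definition swap_tensor :: "'d :: finite tensor" where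
  "swap_tensor = (\<chi> q. case q of (a, b, c, e) \<Rightarrow> (if a = e then 1 else 0) * (if c = b then 1 else 0))"

text \<open>With P and Q the rank-one operators of \<open>x\<close> and \<open>y\<close>, the
  pairing is tr(PQ)^2, and tr(PQ) = |<x,y>|^2.\<close>

lemma cinner_projector_square:
  "cinner (projector_square x) (projector_square y) = complex_of_real (cmod (cinner x y) ^ 4)"
proof -
  \<comment> \<open>The summand is regrouped so that each factor involves one index only; the four
    sums then separate.\<close>
  have "cinner (projector_square x) (projector_square y) =
     (\<Sum>a\<in>UNIV. \<Sum>b\<in>UNIV. \<Sum>c\<in>UNIV. \<Sum>e\<in>UNIV.
       (x $ a * cnj (y $ a)) * ((y $ b * cnj (x $ b)) * ((x $ c * cnj (y $ c)) * (y $ e * cnj (x $ e)))))"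
    unfolding cinner_def sum_UNIV_quadruple projector_square_def
    by (intro sum.cong refl) simp
  also have "\<dots> = cinner x y * (cinner y x * (cinner x y * cinner y x))"
    by (simp only: sum_distrib_left [symmetric] sum_distrib_right [symmetric] cinner_def)
  also have "\<dots> = (cinner x y * cnj (cinner x y))\<^sup>2"
    by (simp add: cnj_cinner power2_eq_square)
  also have "\<dots> = complex_of_real (cmod (cinner x y) ^ 4)"
    by (simp add: complex_norm_square [symmetric] del: of_real_power flip: of_real_power power_mult)
  finally show ?thesis .
qed

text \<open>Pairing with the identity is the trace, and tr(P \<otimes> P) = (tr P)^2.\<close>

lemma cinner_projector_square_identity:
  "cinner (projector_square x) identity_tensor = (cinner x x)\<^sup>2"
proof -
  have "cinner (projector_square x) identity_tensor =
     (\<Sum>a\<in>UNIV. \<Sum>b\<in>UNIV. \<Sum>c\<in>UNIV. \<Sum>e\<in>UNIV.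
       if e = c then if b = a then (x $ a * cnj (x $ b)) * (x $ c * cnj (x $ e)) else 0 else 0)"
    unfolding cinner_def sum_UNIV_quadruple projector_square_def identity_tensor_def
    by (intro sum.cong refl) auto
  also have "\<dots> = (\<Sum>a\<in>UNIV. \<Sum>b\<in>UNIV. if b = a then \<Sum>c\<in>UNIV. (x $ a * cnj (x $ b)) * (x $ c * cnj (x $ c)) else 0)"
    by (intro sum.cong refl) auto
  also have "\<dots> = (cinner x x)\<^sup>2"
    by (simp add: cinner_def power2_eq_square sum_product)
  finally show ?thesis .
qed

text \<open>Pairing with the swap turns P \<otimes> P into tr(P^2), which is (tr P)^2 because P has
  rank one.\<close>

lemma cinner_projector_square_swap:
  "cinner (projector_square x) swap_tensor = (cinner x x)\<^sup>2"
proof -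
  have "cinner (projector_square x) swap_tensor =
     (\<Sum>a\<in>UNIV. \<Sum>b\<in>UNIV. \<Sum>c\<in>UNIV. \<Sum>e\<in>UNIV.
       if e = a then if c = b then (x $ a * cnj (x $ b)) * (x $ c * cnj (x $ e)) else 0 else 0)"
    unfolding cinner_def sum_UNIV_quadruple projector_square_def swap_tensor_def
    by (intro sum.cong refl) auto
  also have "\<dots> = (\<Sum>a\<in>UNIV. \<Sum>b\<in>UNIV. (x $ a * cnj (x $ a)) * (x $ b * cnj (x $ b)))"
    by (intro sum.cong refl) (auto simp: mult_ac)
  also have "\<dots> = (cinner x x)\<^sup>2"
    by (simp add: cinner_def power2_eq_square sum_product)
  finally show ?thesis .
qed

lemma cinner_identity_identity:
  "cinner identity_tensor (identity_tensor :: 'd :: finite tensor) = of_nat CARD('d) ^ 2"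
proof -
  have "cinner identity_tensor (identity_tensor :: 'd tensor) =
     (\<Sum>a\<in>(UNIV :: 'd set). \<Sum>b\<in>(UNIV :: 'd set). \<Sum>c\<in>(UNIV :: 'd set). \<Sum>e\<in>(UNIV :: 'd set).
       if e = c then if b = a then 1 else 0 else 0)"
    unfolding cinner_def sum_UNIV_quadruple identity_tensor_def
    by (intro sum.cong refl) auto
  then show ?thesis by (simp add: power2_eq_square flip: sum_distrib_left)
qed

lemma cinner_swap_swap:
  "cinner swap_tensor (swap_tensor :: 'd :: finite tensor) = of_nat CARD('d) ^ 2"
proof -
  have "cinner swap_tensor (swap_tensor :: 'd tensor) =
     (\<Sum>a\<in>(UNIV :: 'd set). \<Sum>b\<in>(UNIV :: 'd set). \<Sum>c\<in>(UNIV :: 'd set). \<Sum>e\<in>(UNIV :: 'd set).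
       if e = a then if c = b then 1 else 0 else 0)"
    unfolding cinner_def sum_UNIV_quadruple swap_tensor_def
    by (intro sum.cong refl) auto
  then show ?thesis by (simp add: power2_eq_square flip: sum_distrib_left)
qed

text \<open>This is the trace of the swap, to which only the basis tensors with two equal indices
  contribute.\<close>

lemma cinner_swap_identity:
  "cinner swap_tensor (identity_tensor :: 'd :: finite tensor) = of_nat CARD('d)"
proof -
  have "cinner swap_tensor (identity_tensor :: 'd tensor) =
     (\<Sum>a\<in>(UNIV :: 'd set). \<Sum>b\<in>(UNIV :: 'd set). \<Sum>c\<in>(UNIV :: 'd set). \<Sum>e\<in>(UNIV :: 'd set).
       if e = a then if c = b then if b = a then 1 else 0 else 0 else 0)"
    unfolding cinner_def sum_UNIV_quadruple swap_tensor_def identity_tensor_def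
    by (intro sum.cong refl) auto
  then show ?thesis by simp
qed

lemma cinner_identity_swap:
  "cinner identity_tensor (swap_tensor :: 'd :: finite tensor) = of_nat CARD('d)"
  by (metis cnj_cinner cinner_swap_identity complex_cnj_of_nat)

text \<open>For d unit vectors the sum has trace d, and the identity has squared norm d^2, so the
  coefficient 1/d makes the difference orthogonal to the identity. Indexed families cover both the
  columns of a matrix and a basis indexed by itself.\<close>

definition frame_tensor :: "'k set \<Rightarrow> ('k \<Rightarrow> complex ^ 'd :: finite) \<Rightarrow> 'd tensor" where
  "frame_tensor K f = (\<Sum>k\<in>K. projector_square (f k)) - (1 / of_nat CARD('d)) *s identity_tensor"

definition centred_swap :: "'d :: finite tensor" where
  "centred_swap = swap_tensor - (1 / of_nat CARD('d)) *s identity_tensor"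

lemma cinner_frame_identity:
  fixes f :: "'k \<Rightarrow> complex ^ 'd :: finite"
  assumes "card K = CARD('d)" "\<And>k. k \<in> K \<Longrightarrow> cinner (f k) (f k) = 1"
  shows "cinner (frame_tensor K f) identity_tensor = 0"
  using assms by (simp add: frame_tensor_def cinner_diff_left cinner_sum_left cinner_scale_left
      cinner_projector_square_identity cinner_identity_identity power2_eq_square)

lemma cinner_frame_frame:
  fixes f :: "'k \<Rightarrow> complex ^ 'd :: finite" and g :: "'l \<Rightarrow> complex ^ 'd"
  assumes "card K = CARD('d)" "\<And>k. k \<in> K \<Longrightarrow> cinner (f k) (f k) = 1"
    and "card L = CARD('d)" "\<And>l. l \<in> L \<Longrightarrow> cinner (g l) (g l) = 1"
  shows "cinner (frame_tensor K f) (frame_tensor L g) =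
    complex_of_real (- 1 + (\<Sum>k\<in>K. \<Sum>l\<in>L. cmod (cinner (f k) (g l)) ^ 4))"
proof -
  have *: "cinner identity_tensor (projector_square (g l)) = 1" if "l \<in> L" for l
    by (subst cnj_cinner [symmetric]) (simp add: cinner_projector_square_identity assms(4) that)
  \<comment> \<open>The centring term on the right drops out by orthogonality to the identity; the
    one on the left contributes -(1/d) * d = -1.\<close>
  have "cinner (frame_tensor K f) (frame_tensor L g) =
      cinner (frame_tensor K f) (\<Sum>l\<in>L. projector_square (g l))"
    by (simp add: frame_tensor_def [of L] cinner_diff_right cinner_scale_right
        cinner_frame_identity assms(1,2))
  also have "\<dots> = (\<Sum>k\<in>K. \<Sum>l\<in>L. cinner (projector_square (f k)) (projector_square (g l))) - 1"
    by (simp add: frame_tensor_def cinner_diff_left cinner_scale_left cinner_sum_left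
        cinner_sum_right sum_subtractf * assms(3)) (rule sum.swap)
  finally show ?thesis
    by (simp add: cinner_projector_square)
qed

lemma cinner_frame_swap:
  fixes f :: "'k \<Rightarrow> complex ^ 'd :: finite"
  assumes "card K = CARD('d)" "\<And>k. k \<in> K \<Longrightarrow> cinner (f k) (f k) = 1"
  shows "cinner (frame_tensor K f) centred_swap = of_nat CARD('d) - 1"
proof -
  have "cinner (frame_tensor K f) centred_swap = cinner (frame_tensor K f) swap_tensor"
    by (simp add: centred_swap_def cinner_diff_right cinner_scale_right cinner_frame_identity assms)
  also have "\<dots> = of_nat CARD('d) - 1"
    by (simp add: frame_tensor_def cinner_diff_left cinner_sum_left cinner_scale_left
      cinner_projector_square_swap cinner_identity_swap assms)
  finally show ?thesis .
qed

lemma cinner_centred_swap: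
  "cinner centred_swap (centred_swap :: 'd :: finite tensor) = of_nat CARD('d) ^ 2 - 1"
  by (simp add: centred_swap_def cinner_diff_left cinner_diff_right cinner_scale_left
      cinner_scale_right cinner_identity_identity cinner_swap_swap cinner_swap_identity
      cinner_identity_swap power2_eq_square)

section \<open>Positive definiteness on the unitary group\<close>

lemma unitary_column_unit:
  assumes "Z \<in> carrier unitary_group"
  shows "cinner (column k Z) (column k Z) = 1"
proof -
  have "(conj_transpose Z ** Z) $ k $ k = 1"
    using assms by (simp add: unitary_group_def mat_def)
  then show ?thesis
    by (simp add: cinner_def column_def conj_transpose_def matrix_matrix_mult_def mult.commute)
qed

lemma inv_unitary_group:
  assumes "Z \<in> carrier unitary_group"
  shows "inv\<^bsub>unitary_group\<^esub> Z = conj_transpose Z"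
  using assms group.inv_equality [OF group_unitary_group, of "conj_transpose Z" Z]
  by (simp add: unitary_group_def)

text \<open>The entries of \<open>conj_transpose U ** V\<close> are inner products of columns, so h
  becomes a Gram kernel. The tensor of \<open>V\<close> takes the linear slot, where the coefficient
  \<open>c j\<close> will sit.\<close>

lemma mub_function_quotient:
  assumes "U \<in> carrier unitary_group" "V \<in> carrier unitary_group"
  shows "complex_of_real (mub_function (inv\<^bsub>unitary_group\<^esub> U \<otimes>\<^bsub>unitary_group\<^esub> V)) =
    cinner (frame_tensor UNIV (\<lambda>k. column k V)) (frame_tensor UNIV (\<lambda>k. column k U))"
proof -
  have "(conj_transpose U ** V) $ k $ l = cinner (column l V) (column k U)" for k l
    by (simp add: cinner_def column_def conj_transpose_def matrix_matrix_mult_def mult.commute)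
  then have "mub_function (inv\<^bsub>unitary_group\<^esub> U \<otimes>\<^bsub>unitary_group\<^esub> V) =
    - 1 + (\<Sum>k\<in>UNIV. \<Sum>l\<in>UNIV. cmod (cinner (column l V) (column k U)) ^ 4)"
    by (simp add: mub_function_def inv_unitary_group assms) (simp add: unitary_group_def)
  also have "\<dots> = - 1 + (\<Sum>l\<in>UNIV. \<Sum>k\<in>UNIV. cmod (cinner (column l V) (column k U)) ^ 4)"
    by (subst sum.swap) simp
  finally show ?thesis
    by (simp add: cinner_frame_frame unitary_column_unit assms)
qed

lemma positive_definite_mub_function:
  "positive_definite (unitary_group :: (complex ^ 'd ^ 'd :: finite) monoid)
     (\<lambda>Z. complex_of_real (mub_function Z))"
  unfolding positive_definite_def
proof (intro allI impI)
  fix m :: nat and u :: "nat \<Rightarrow> complex ^ 'd ^ 'd" and c :: "nat \<Rightarrow> complex"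
  assume u: "\<forall>i\<in>{1..m}. u i \<in> carrier unitary_group"
  define T where "T i = frame_tensor UNIV (\<lambda>k. column k (u i))" for i
  \<comment> \<open>The quadratic form is the squared norm of this combination.\<close>
  define v where "v = (\<Sum>j=1..m. c j *s T j)"
  have "(\<Sum>i=1..m. \<Sum>j=1..m. complex_of_real
      (mub_function (inv\<^bsub>unitary_group\<^esub> (u i) \<otimes>\<^bsub>unitary_group\<^esub> u j)) * cnj (c i) * c j) =
    (\<Sum>i=1..m. \<Sum>j=1..m. cinner (T j) (T i) * cnj (c i) * c j)"
    using u by (intro sum.cong refl) (simp add: mub_function_quotient T_def)
  also have "\<dots> = cinner v v"
    unfolding v_def cinner_sum_right cinner_sum_left cinner_scale_left cinner_scale_right
    by (simp add: mult_ac sum_distrib_left)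
  finally show "(\<Sum>i=1..m. \<Sum>j=1..m. complex_of_real
      (mub_function (inv\<^bsub>unitary_group\<^esub> (u i) \<otimes>\<^bsub>unitary_group\<^esub> u j)) * cnj (c i) * c j) \<in> \<real>\<^sub>\<ge>\<^sub>0"
    using cinner_self_nonneg [of v] by simp
qed

lemma mub_function_mat_1: "mub_function (mat 1 :: complex ^ 'd ^ 'd :: finite) = real CARD('d) - 1"
proof -
  have "(\<Sum>i\<in>(UNIV :: 'd set). \<Sum>j\<in>(UNIV :: 'd set). cmod ((mat 1 :: complex ^ 'd ^ 'd) $ i $ j) ^ 4) =
      (\<Sum>i\<in>(UNIV :: 'd set). \<Sum>j\<in>(UNIV :: 'd set). if j = i then 1 else 0)"
    by (intro sum.cong refl) (auto simp: mat_def)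
  then show ?thesis by (simp add: mub_function_def)
qed

section \<open>The bound on mutually unbiased bases\<close>

text \<open>Pairing a linear relation with one of its vectors isolates that vector's coefficient, so
  the set is independent; as it also spans, its size is the dimension.\<close>

lemma card_orthonormal_basis:
  fixes B :: "(complex ^ 'd :: finite) set"
  assumes "orthonormal_basis B"
  shows "finite B" "card B = CARD('d)"
proof -
  have on: "\<And>x y. x \<in> B \<Longrightarrow> y \<in> B \<Longrightarrow> cinner x y = (if x = y then 1 else 0)"
    and sp: "vec.span B = UNIV"
    using assms by (auto simp: orthonormal_basis_def)
  have ind: "vec.independent B"
    unfolding vec.independent_explicit_finite_subsets
  proof (intro allI impI ballI)
    fix S u v
    assume S: "S \<subseteq> B" "finite S" "(\<Sum>w\<in>S. u w *s w) = 0" and v: "v \<in> S"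
    have "(\<Sum>w\<in>S. u w * cinner w v) = cinner (\<Sum>w\<in>S. u w *s w) v"
      by (simp only: cinner_sum_left cinner_scale_left)
    also have "\<dots> = 0"
      using S by (simp add: cinner_def)
    also have "(\<Sum>w\<in>S. u w * cinner w v) = (\<Sum>w\<in>S. if w = v then u w else 0)"
    proof (rule sum.cong)
      fix w assume "w \<in> S"
      then show "u w * cinner w v = (if w = v then u w else 0)"
        using on [OF subsetD [OF S(1)] subsetD [OF S(1) v]] by simp
    qed simp
    finally show "u v = 0"
      using S v by simp
  qed
  show "finite B" using ind by (rule vec.finiteI_independent)
  show "card B = CARD('d)"
    using vec.dim_span_eq_card_independent [OF ind] by (simp only: sp vec_dim_card)
qed

lemma mutually_unbiased_bases_bound:
  fixes B :: "nat \<Rightarrow> (complex ^ 'd :: finite) set"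
  assumes d: "CARD('d) \<ge> 2" and mub: "mutually_unbiased_bases m B"
  shows "m \<le> CARD('d) + 1"
proof (cases "m = 0")
  case False
  define d where "d = real CARD('d)"
  have d2: "d \<ge> 2" using d by (simp add: d_def)
  define T where "T i = frame_tensor (B i) (\<lambda>x. x)" for i
  have basis: "orthonormal_basis (B i)" if "i \<in> {1..m}" for i
    using mub that by (auto simp: mutually_unbiased_bases_def)
  have unit: "cinner x x = 1" if "i \<in> {1..m}" "x \<in> B i" for i x
    using basis that by (auto simp: orthonormal_basis_def)
  note card = card_orthonormal_basis [OF basis]
  have TT: "cinner (T i) (T j) = complex_of_real (if i = j then d - 1 else 0)"
    if ij: "i \<in> {1..m}" "j \<in> {1..m}" for i j
  proof -
    \<comment> \<open>Within one basis d terms equal 1. Across two bases d^2 terms equal 1/d^2, and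
      their total 1 cancels the -1 from centring.\<close>
    have "(\<Sum>x\<in>B i. \<Sum>y\<in>B j. cmod (cinner x y) ^ 4) = (if i = j then d else 1)"
    proof (cases "i = j")
      case True
      have "(\<Sum>x\<in>B i. \<Sum>y\<in>B j. cmod (cinner x y) ^ 4) = (\<Sum>x\<in>B i. \<Sum>y\<in>B i. if y = x then 1 else 0)"
        using basis ij True by (intro sum.cong refl) (auto simp: orthonormal_basis_def)
      also have "\<dots> = d" using card [OF ij(1)] by (simp add: d_def)
      finally show ?thesis using True by simp
    next
      case False
      have "cmod (cinner x y) = 1 / sqrt d" if "x \<in> B i" "y \<in> B j" for x y
        using mub ij False that by (auto simp: mutually_unbiased_bases_def unbiased_def d_def)
      moreover have "(1 / sqrt d) ^ 4 = 1 / (d * d)"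
        using d2 by (simp add: power_divide power4_eq_xxxx)
      ultimately have "(\<Sum>x\<in>B i. \<Sum>y\<in>B j. cmod (cinner x y) ^ 4) = (\<Sum>x\<in>B i. \<Sum>y\<in>B j. 1 / (d * d))"
        by (intro sum.cong refl) simp
      also have "\<dots> = 1" using card [OF ij(1)] card [OF ij(2)] d2 by (simp add: d_def)
      finally show ?thesis using False by simp
    qed
    moreover have "cinner (T i) (T j) =
        complex_of_real (- 1 + (\<Sum>x\<in>B i. \<Sum>y\<in>B j. cmod (cinner x y) ^ 4))"
      unfolding T_def by (intro cinner_frame_frame card unit [OF ij(1)] unit [OF ij(2)] ij)
    ultimately show ?thesis by simp
  qed
  have TF: "cinner (T i) centred_swap = complex_of_real (d - 1)" if "i \<in> {1..m}" for i
    unfolding T_def using that by (simp add: cinner_frame_swap card unit d_def)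
  have FF: "cinner centred_swap (centred_swap :: 'd tensor) = complex_of_real (d\<^sup>2 - 1)"
    by (simp add: cinner_centred_swap d_def)
  \<comment> \<open>\<open>s\<close> minimises the squared norm of \<open>v = S - s F\<close>, with \<open>F\<close> the centred swap.\<close>
  define s where "s = real m / (d + 1)"
  define S where "S = (\<Sum>i=1..m. T i)"
  have "cinner S S = (\<Sum>j=1..m. \<Sum>i=1..m. cinner (T i) (T j))"
    by (simp only: S_def cinner_sum_left cinner_sum_right)
  also have "\<dots> = (\<Sum>j=1..m. \<Sum>i=1..m. if i = j then complex_of_real (d - 1) else 0)"
    by (intro sum.cong refl) (simp add: TT)
  finally have SS: "cinner S S = complex_of_real (real m * (d - 1))"
    by simp
  have SF: "cinner S centred_swap = complex_of_real (real m * (d - 1))"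
    by (simp add: S_def cinner_sum_left TF)
  have FS: "cinner centred_swap S = complex_of_real (real m * (d - 1))"
    using cnj_cinner [of S centred_swap] SF by simp
  define v where "v = S - complex_of_real s *s centred_swap"
  have "cinner v v = complex_of_real (real m * (d - 1) - 2 * s * (real m * (d - 1)) + s * s * (d\<^sup>2 - 1))"
    by (simp add: v_def cinner_diff_left cinner_diff_right cinner_scale_left cinner_scale_right
        SS SF FS FF algebra_simps)
  then have "0 \<le> real m * (d - 1) - 2 * s * (real m * (d - 1)) + s * s * (d\<^sup>2 - 1)"
    using cinner_self_nonneg [of v] by (simp only: nonneg_Reals_of_real_iff)
  \<comment> \<open>The choice of \<open>s\<close> gives s (d^2 - 1) = m (d - 1), which merges the
    last two terms.\<close>
  also have "\<dots> = real m * (d - 1) * (1 - s)"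
    using d2 by (simp add: s_def divide_simps) (simp add: algebra_simps power2_eq_square)
  finally have "s \<le> 1"
    using d2 False zero_le_mult_iff [of "real m * (d - 1)" "1 - s"]
      mult_pos_pos [of "real m" "d - 1"] by linarith
  then have "real m \<le> d + 1" using d2 by (simp add: s_def divide_simps)
  then show ?thesis by (simp add: d_def)
qed simp

section \<open>Haar measure and invariance of integrals\<close>

lemma borel_measurable_entry [measurable]:
  "(\<lambda>Z :: complex ^ 'd ^ 'd :: finite. Z $ i $ j) \<in> borel_measurable borel"
  by (intro borel_measurable_continuous_onI continuous_intros)

lemma normalized_haar_measure_sets:
  "normalized_haar_measure \<mu> \<Longrightarrow> sets \<mu> = sets (restrict_space borel (carrier unitary_group))"
  by (simp add: normalized_haar_measure_def)

lemma normalized_haar_measure_space: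
  "normalized_haar_measure \<mu> \<Longrightarrow> space \<mu> = carrier unitary_group"
  using sets_eq_imp_space_eq [OF normalized_haar_measure_sets] by (simp add: space_restrict_space)

text \<open>The pushforward of \<open>\<mu>\<close> under left multiplication by \<open>g\<close> is
  \<open>\<mu>\<close> itself, so a change of variables applies.\<close>

lemma normalized_haar_measure_integral_translate:
  fixes f :: "complex ^ 'd ^ 'd :: finite \<Rightarrow> real"
  assumes haar: "normalized_haar_measure \<mu>" and g: "g \<in> carrier unitary_group"
    and f: "f \<in> borel_measurable borel"
  shows "(\<integral>Z. f (g ** Z) \<partial>\<mu>) = integral\<^sup>L \<mu> f"
proof -
  note sets = normalized_haar_measure_sets [OF haar]
  note space = normalized_haar_measure_space [OF haar]
  interpret group "unitary_group :: (complex ^ 'd ^ 'd) monoid"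
    by (rule group_unitary_group)
  have mult: "X \<otimes>\<^bsub>unitary_group\<^esub> Y = X ** Y" for X Y :: "complex ^ 'd ^ 'd"
    by (simp add: unitary_group_def)
  have "(\<lambda>Z. g ** Z) \<in> borel_measurable borel"
    unfolding matrix_matrix_mult_def
    by (intro borel_measurable_continuous_onI continuous_intros)
  then have "(\<lambda>Z. g ** Z) \<in> restrict_space borel (carrier unitary_group) \<rightarrow>\<^sub>M
      restrict_space borel (carrier unitary_group)"
    using m_closed [OF g]
    by (intro measurable_restrict_space2 measurable_restrict_space1)
       (auto simp: space_restrict_space mult)
  then have T: "(\<lambda>Z. g ** Z) \<in> \<mu> \<rightarrow>\<^sub>M \<mu>"
    by (simp add: measurable_cong_sets [OF sets sets])
  have "distr \<mu> \<mu> (\<lambda>Z. g ** Z) = \<mu>"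
  proof (rule measure_eqI)
    fix A assume "A \<in> sets (distr \<mu> \<mu> (\<lambda>Z. g ** Z))"
    then have A: "A \<in> sets \<mu>" by simp
    have sub: "A \<subseteq> carrier unitary_group"
      using sets.sets_into_space [OF A] by (simp add: space)
    \<comment> \<open>Invariance is stated for images but a pushforward uses preimages; a preimage
      under \<open>g\<close> is an image under its inverse.\<close>
    have "(\<lambda>Z. g ** Z) -` A \<inter> space \<mu> =
        (\<lambda>Z. inv\<^bsub>unitary_group\<^esub> g \<otimes>\<^bsub>unitary_group\<^esub> Z) ` A"
    proof (intro equalityI subsetI)
      fix Z assume "Z \<in> (\<lambda>Z. g ** Z) -` A \<inter> space \<mu>"
      then show "Z \<in> (\<lambda>Z. inv\<^bsub>unitary_group\<^esub> g \<otimes>\<^bsub>unitary_group\<^esub> Z) ` A"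
        using g inv_solve_left' [OF g, of Z "g ** Z"]
        by (intro image_eqI [of _ _ "g ** Z"]) (auto simp: space simp flip: mult m_assoc)
    next
      fix Z assume "Z \<in> (\<lambda>Z. inv\<^bsub>unitary_group\<^esub> g \<otimes>\<^bsub>unitary_group\<^esub> Z) ` A"
      then show "Z \<in> (\<lambda>Z. g ** Z) -` A \<inter> space \<mu>"
        using g sub by (auto simp: space subset_iff simp flip: mult m_assoc)
    qed
    then show "emeasure (distr \<mu> \<mu> (\<lambda>Z. g ** Z)) A = emeasure \<mu> A"
      using haar g A by (simp add: emeasure_distr [OF T A] normalized_haar_measure_def)
  qed simp
  moreover have "f \<in> borel_measurable \<mu>"
    using measurable_restrict_space1 [OF f] by (simp add: measurable_cong_sets [OF sets refl])
  ultimately show ?thesis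
    using integral_distr [OF T, of f] by simp
qed

section \<open>Unitary mixing of two coordinates\<close>

text \<open>For \<open>i \<noteq> k\<close> this is a Hadamard matrix on coordinates
  \<open>i\<close> and \<open>k\<close>, applied after multiplying coordinate \<open>k\<close> by
  \<open>\<zeta>\<close>.\<close>

definition mixing_matrix :: "'d :: finite \<Rightarrow> 'd \<Rightarrow> complex \<Rightarrow> complex ^ 'd ^ 'd" where
  "mixing_matrix i k \<zeta> = (\<chi> a b.
     if a = i then complex_of_real (sqrt (1 / 2)) * ((if b = i then 1 else 0) + \<zeta> * (if b = k then 1 else 0))
     else if a = k then complex_of_real (sqrt (1 / 2)) * ((if b = i then 1 else 0) - \<zeta> * (if b = k then 1 else 0))
     else if b = a then 1 else 0)"

lemma mixing_matrix_mult:
  "(mixing_matrix i k \<zeta> ** Z) $ a $ j =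
     (if a = i then complex_of_real (sqrt (1 / 2)) * (Z $ i $ j + \<zeta> * Z $ k $ j)
      else if a = k then complex_of_real (sqrt (1 / 2)) * (Z $ i $ j - \<zeta> * Z $ k $ j)
      else Z $ a $ j)"
proof -
  have *: "(\<Sum>b\<in>UNIV. (if b = c then 1 else 0) * Z $ b $ j) = Z $ c $ j" for c
  proof -
    have "(\<Sum>b\<in>UNIV. (if b = c then 1 else 0) * Z $ b $ j) = (\<Sum>b\<in>UNIV. if b = c then Z $ b $ j else 0)"
      by (intro sum.cong refl) simp
    then show ?thesis by simp
  qed
  show ?thesis
    by (simp add: mixing_matrix_def matrix_matrix_mult_def distrib_right left_diff_distrib
        sum.distrib sum_subtractf mult.assoc * flip: sum_distrib_left)
qed

lemma mixing_matrix_unitary: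
  fixes i k :: "'d :: finite"
  assumes "i \<noteq> k" "\<zeta> * cnj \<zeta> = 1"
  shows "mixing_matrix i k \<zeta> \<in> carrier unitary_group"
proof -
  define s where "s = complex_of_real (sqrt (1 / 2))"
  have s: "s * s = 1 / 2" "cnj s = s"
    by (simp_all add: s_def flip: of_real_mult)
  have s': "s * (s * z) = z / 2" for z
    using s(1) by (simp flip: mult.assoc)
  have "mixing_matrix i k \<zeta> ** conj_transpose (mixing_matrix i k \<zeta>) = mat 1"
    unfolding vec_eq_iff mixing_matrix_mult
    using assms
    by (auto simp: mat_def conj_transpose_def mixing_matrix_def s' s algebra_simps simp flip: s_def)
  \<comment> \<open>For square matrices a one-sided inverse is two-sided.\<close>
  moreover from this have "conj_transpose (mixing_matrix i k \<zeta>) ** mixing_matrix i k \<zeta> = mat 1"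
    by (simp only: matrix_left_right_inverse)
  ultimately show ?thesis
    by (simp add: unitary_group_def)
qed

text \<open>The cross terms of the squared moduli are 2 Re(z cnj w) up to sign for the first pair
  and 2 Im(z cnj w) for the second; over both pairs their squares add up to a multiple of |z|^2
  |w|^2.\<close>

lemma cmod_power4_average:
  "(cmod (z + w) ^ 4 + cmod (z - w) ^ 4) + (cmod (z + \<i> * w) ^ 4 + cmod (z - \<i> * w) ^ 4) =
    4 * (cmod z ^ 4 + cmod w ^ 4 + 4 * ((cmod z)\<^sup>2 * (cmod w)\<^sup>2))"
proof -
  have *: "cmod x ^ 4 = ((Re x)\<^sup>2 + (Im x)\<^sup>2)\<^sup>2" for x
    by (simp add: cmod_power2 flip: power_mult [of "cmod x" 2 2, simplified])
  show ?thesis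
    unfolding * cmod_power2 by (simp add: power2_eq_square algebra_simps)
qed

section \<open>Fourth moments of a column and the integral of h\<close>

lemma unitary_column_sum:
  assumes "Z \<in> carrier unitary_group"
  shows "(\<Sum>i\<in>UNIV. (cmod (Z $ i $ j))\<^sup>2) = 1"
  using unitary_column_unit [OF assms, of j]
  by (simp add: cinner_self column_def del: of_real_sum of_real_power)

lemma unitary_entry_le_1:
  assumes "Z \<in> carrier unitary_group"
  shows "cmod (Z $ i $ j) \<le> 1"
proof -
  have "(cmod (Z $ i $ j))\<^sup>2 \<le> (\<Sum>i\<in>UNIV. (cmod (Z $ i $ j))\<^sup>2)"
    by (rule member_le_sum) auto
  then show ?thesis
    by (simp add: unitary_column_sum [OF assms] power_le_one_iff abs_square_le_1)
qed

lemma normalized_haar_measure_integrable: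
  fixes f :: "complex ^ 'd ^ 'd :: finite \<Rightarrow> real"
  assumes haar: "normalized_haar_measure \<mu>" and f: "f \<in> borel_measurable borel"
    and bound: "\<And>Z. Z \<in> carrier unitary_group \<Longrightarrow> \<bar>f Z\<bar> \<le> C"
  shows "integrable \<mu> f"
proof -
  interpret finite_measure \<mu>
    using haar by (intro finite_measureI) (simp add: normalized_haar_measure_def)
  have "f \<in> borel_measurable \<mu>"
    using measurable_restrict_space1 [OF f]
    by (simp add: measurable_cong_sets [OF normalized_haar_measure_sets [OF haar] refl])
  then show ?thesis
    using bound by (intro integrable_const_bound [of _ C])
      (auto simp: normalized_haar_measure_space [OF haar])
qed

lemma normalized_haar_measure_column:
  fixes \<mu> :: "(complex ^ 'd ^ 'd :: finite) measure"
  assumes haar: "normalized_haar_measure \<mu>"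
  shows "(\<Sum>i\<in>UNIV. \<integral>Z. cmod (Z $ i $ j) ^ 4 \<partial>\<mu>) = 2 / (real CARD('d) + 1)"
proof -
  define A where "A i = (\<integral>Z. cmod (Z $ i $ j) ^ 4 \<partial>\<mu>)" for i
  define B where "B i k = (\<integral>Z. (cmod (Z $ i $ j))\<^sup>2 * (cmod (Z $ k $ j))\<^sup>2 \<partial>\<mu>)" for i k
  have int4: "integrable \<mu> (\<lambda>Z. cmod (Z $ i $ j) ^ 4)" for i
    by (rule normalized_haar_measure_integrable [OF haar, where C = 1])
       (auto simp: power_le_one unitary_entry_le_1)
  have int22: "integrable \<mu> (\<lambda>Z. (cmod (Z $ i $ j))\<^sup>2 * (cmod (Z $ k $ j))\<^sup>2)" for i k
    by (rule normalized_haar_measure_integrable [OF haar, where C = 1])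
       (auto simp: power_le_one unitary_entry_le_1 abs_mult intro!: mult_le_one)
  have mixed: "4 * B i k = A i + A k" if "i \<noteq> k" for i k
  proof -
    define F where "F Z = cmod (Z $ i $ j) ^ 4 + cmod (Z $ k $ j) ^ 4" for Z :: "complex ^ 'd ^ 'd"
    have F: "F \<in> borel_measurable borel"
      unfolding F_def by measurable
    have int_F: "integral\<^sup>L \<mu> F = A i + A k"
      unfolding F_def A_def by (intro Bochner_Integration.integral_add int4)
    have mix: "integrable \<mu> (\<lambda>Z. F (mixing_matrix i k \<zeta> ** Z)) \<and>
        (\<integral>Z. F (mixing_matrix i k \<zeta> ** Z) \<partial>\<mu>) = A i + A k" if \<zeta>: "\<zeta> * cnj \<zeta> = 1" for \<zeta>
    proof
      note g = mixing_matrix_unitary [OF \<open>i \<noteq> k\<close> \<zeta>]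
      show "(\<integral>Z. F (mixing_matrix i k \<zeta> ** Z) \<partial>\<mu>) = A i + A k"
        by (simp only: normalized_haar_measure_integral_translate [OF haar g F] int_F)
      \<comment> \<open>The product stays unitary, so each of the two fourth powers in
        \<open>F\<close> is at most 1.\<close>
      have "\<bar>F (mixing_matrix i k \<zeta> ** Z)\<bar> \<le> 2" if "Z \<in> carrier unitary_group" for Z
      proof -
        have "mixing_matrix i k \<zeta> ** Z \<in> carrier unitary_group"
          using monoid.m_closed [OF group.is_monoid [OF group_unitary_group] g that]
          by (simp add: unitary_group_def)
        from unitary_entry_le_1 [OF this] show ?thesis
          unfolding F_def using power_le_one [of "cmod _" 4]
          by (smt (verit) norm_ge_zero zero_le_power)
      qed
      then show "integrable \<mu> (\<lambda>Z. F (mixing_matrix i k \<zeta> ** Z))"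
        by (intro normalized_haar_measure_integrable [OF haar, where C = 2])
           (auto simp: F_def mixing_matrix_mult)
    qed
    \<comment> \<open>The factor (1/sqrt 2)^4 = 1/4 cancels the 4 in
      \<open>cmod_power4_average\<close>.\<close>
    have pointwise: "F (mixing_matrix i k 1 ** Z) + F (mixing_matrix i k \<i> ** Z) =
        F Z + 4 * ((cmod (Z $ i $ j))\<^sup>2 * (cmod (Z $ k $ j))\<^sup>2)" for Z
    proof -
      have "sqrt (1 / 2) ^ 4 = (1 / 4 :: real)"
        by (simp add: power4_eq_xxxx)
      then have *: "cmod (complex_of_real (sqrt (1 / 2)) * z) ^ 4 = cmod z ^ 4 / 4" for z
        by (simp only: norm_mult norm_of_real power_mult_distrib power_even_abs_numeral even_numeral)
      then show ?thesis
        using cmod_power4_average [of "Z $ i $ j" "Z $ k $ j"] \<open>i \<noteq> k\<close> \<open>i \<noteq> k\<close> [symmetric]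
        by (simp add: F_def mixing_matrix_mult * del: real_sqrt_divide)
    qed
    have "2 * (A i + A k) = (\<integral>Z. F (mixing_matrix i k 1 ** Z) + F (mixing_matrix i k \<i> ** Z) \<partial>\<mu>)"
      using mix [of 1] mix [of \<i>] by simp
    also have "\<dots> = A i + A k + 4 * B i k"
      unfolding pointwise by (simp add: F_def A_def B_def int4 int22)
    finally show ?thesis by simp
  qed
  have diag: "B i i = A i" for i
    unfolding A_def B_def by (simp flip: power_add)
  \<comment> \<open>On the diagonal the off-diagonal formula gives only half of \<open>A i\<close>;
    the last summand restores the other half.\<close>
  have "B i k = A i / 4 + A k / 4 + (if k = i then A i / 2 else 0)" for i k
    using mixed [of i k] diag [of i] by auto
  then have "(\<Sum>i\<in>UNIV. \<Sum>k\<in>UNIV. B i k) =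
      (\<Sum>i\<in>UNIV. \<Sum>k\<in>UNIV. A i / 4 + A k / 4 + (if k = i then A i / 2 else 0))"
    by simp
  \<comment> \<open>The two quarter terms contribute d/4 each and the diagonal correction
    1/2.\<close>
  also have "\<dots> = (real CARD('d) + 1) / 2 * (\<Sum>i\<in>UNIV. A i)"
    by (simp add: sum.distrib flip: sum_distrib_left sum_divide_distrib) (simp add: algebra_simps)
  also have "(\<Sum>i\<in>UNIV. \<Sum>k\<in>UNIV. B i k) =
      (\<integral>Z. (\<Sum>i\<in>UNIV. \<Sum>k\<in>UNIV. (cmod (Z $ i $ j))\<^sup>2 * (cmod (Z $ k $ j))\<^sup>2) \<partial>\<mu>)"
    unfolding B_def by (simp add: int22)
  \<comment> \<open>On the group the double sum is the square of a column's squared norm.\<close>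
  also have "\<dots> = (\<integral>Z. 1 \<partial>\<mu>)"
    by (rule Bochner_Integration.integral_cong)
       (simp_all add: normalized_haar_measure_space [OF haar] unitary_column_sum flip: sum_product)
  also have "\<dots> = 1"
    using haar by (simp add: normalized_haar_measure_def measure_def)
  finally show ?thesis
    unfolding A_def by (simp add: field_simps)
qed

lemma normalized_haar_measure_integral_mub_function:
  fixes \<mu> :: "(complex ^ 'd ^ 'd :: finite) measure"
  assumes haar: "normalized_haar_measure \<mu>"
  shows "integral\<^sup>L \<mu> mub_function = (real CARD('d) - 1) / (real CARD('d) + 1)"
proof -
  have int4: "integrable \<mu> (\<lambda>Z. cmod (Z $ i $ j) ^ 4)" for i j
    by (rule normalized_haar_measure_integrable [OF haar, where C = 1])
       (auto simp: power_le_one unitary_entry_le_1)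
  have const: "integrable \<mu> (\<lambda>Z. - 1 :: real)"
    by (rule normalized_haar_measure_integrable [OF haar, where C = 1]) auto
  have "measure \<mu> (space \<mu>) = 1"
    using haar by (simp add: normalized_haar_measure_def measure_def)
  then have "integral\<^sup>L \<mu> mub_function =
      - 1 + (\<Sum>i\<in>UNIV. \<Sum>j\<in>UNIV. \<integral>Z. cmod (Z $ i $ j) ^ 4 \<partial>\<mu>)"
    unfolding mub_function_def
    by (subst Bochner_Integration.integral_add [OF const]) (simp_all add: int4)
  \<comment> \<open>After the sums are exchanged, each of the d columns contributes the same
    moment.\<close>
  also have "\<dots> = - 1 + (\<Sum>j\<in>(UNIV :: 'd set). 2 / (real CARD('d) + 1))"
    by (subst sum.swap) (simp only: normalized_haar_measure_column [OF haar])
  also have "\<dots> = (real CARD('d) - 1) / (real CARD('d) + 1)"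
    by (simp add: field_simps)
  finally show ?thesis .
qed

theorem theorem2p4:
  shows "positive_definite (unitary_group :: (complex ^ 'd ^ 'd :: finite) monoid)
           (\<lambda>Z. complex_of_real (mub_function Z)) \<and>
         mub_function (mat 1 :: complex ^ 'd ^ 'd) = real CARD('d) - 1 \<and>
         (\<forall>\<mu> :: (complex ^ 'd ^ 'd) measure. normalized_haar_measure \<mu> \<longrightarrow>
            integral\<^sup>L \<mu> mub_function = (real CARD('d) - 1) / (real CARD('d) + 1)) \<and>
         (CARD('d) \<ge> 2 \<longrightarrow>
            (\<forall>m (B :: nat \<Rightarrow> (complex ^ 'd) set).
               mutually_unbiased_bases m B \<longrightarrow> m \<le> CARD('d) + 1))"
  using positive_definite_mub_function mub_function_mat_1
    normalized_haar_measure_integral_mub_function mutually_unbiased_bases_bound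
  by blast

end
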